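(* Let $\mathscr G$ be a non-deterministic functor, $\mathscr F$ an ingredient of $\mathscr G$ ($\mathscr F\lhd\mathscr G$), $\mathcal R\subseteq\mathsf{Exp}_{\mathscr G}\times\mathsf{Exp}_{\mathscr G}$ a binary relation on the set of $\mathscr G$-expressions, and $\sigma,\sigma'\in\mathscr F(\mathsf{Exp}_{\mathscr G})$. (a) If $\mathscr G$ is not a constant functor, then $(\sigma,\sigma')\in\overline{\mathscr F}(cl(\mathcal R_{id}))$ if and only if $\mathcal E_{\mathscr G}\cup\langle\mathcal R\rangle\vdash_{NDF}\langle\sigma\rangle=\langle\sigma'\rangle$. (b) If $\mathscr G$ is a constant functor $\mathsf B$, then $(\sigma,\sigma')\in\overline{\mathsf B}(cl(\mathcal R_{id}))$ if and only if $\mathcal E_{\mathscr G}\vdash_{NDF}\langle\sigma\rangle=\langle\sigma'\rangle$.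
   Context: Non-deterministic functors $\mathscr{G}:\mathbf{Set}\to\mathbf{Set}$ are generated by $\mathscr{G}::= Id \mid \mathsf{B}\mid \mathscr{G}\,\hat{+}\,\mathscr{G}\mid \mathscr{G}\times\mathscr{G}\mid \mathscr{G}^A\mid \mathcal{P}_\omega\mathscr{G}$, where $\mathsf{B}$ is a finite join-semilattice (join $\vee$, bottom $\bot_{\mathsf B}$), $A$ a finite set, $\mathcal{P}_\omega$ the finite powerset functor, and $X\,\hat{+}\,Y=X\uplus Y\uplus\{\bot,\top\}$ (injections $\kappa_1,\kappa_2$; on maps, $f_1\hat+f_2$ fixes $\bot,\top$ and sends $\kappa_i(x)$ to $\kappa_i(f_i(x))$). A functor is constant if it is a semilattice $\mathsf B$. The ingredient relation $\lhd$ is the least reflexive and transitive relation with $\mathscr{G}_i\lhd\mathscr{G}_1\times\mathscr{G}_2$, $\mathscr{G}_i\lhd\mathscr{G}_1\hat{+}\mathscr{G}_2$ ($i=1,2$), $\mathscr{G}\lhd\mathscr{G}^A$, $\mathscr{G}\lhd\mathcal{P}_\omega\mathscr{G}$. For a functor $\mathscr F$ and a relation $R\subseteq X\times X$, the lifting is $\overline{\mathscr F}(R)=\{(\mathscr F(\pi_1)(z),\mathscr F(\pi_2)(z))\mid z\in\mathscr F(R)\}$. Expressions: $\varepsilon::= x\mid\varepsilon\oplus\varepsilon\mid\gamma$, $\gamma::=\emptyset\mid\gamma\oplus\gamma\mid\mu x.\gamma\mid b\mid l\langle\varepsilon\rangle\mid r\langle\varepsilon\rangle\mid l[\varepsilon]\mid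 r[\varepsilon]\mid a(\varepsilon)\mid\{\varepsilon\}$ ($x$ fixed-point variables, $b\in\mathsf B$, $a\in A$). Typing $\vdash\varepsilon:\mathscr F\lhd\mathscr G$ is the least relation with: $\emptyset:\mathscr F\lhd\mathscr G$; $b:\mathsf B\lhd\mathscr G$; $x:\mathscr G\lhd\mathscr G$; $\mu x.\varepsilon:\mathscr G\lhd\mathscr G$ if $\varepsilon:\mathscr G\lhd\mathscr G$; $\varepsilon_1\oplus\varepsilon_2:\mathscr F\lhd\mathscr G$ if both $\varepsilon_i:\mathscr F\lhd\mathscr G$; $\varepsilon:Id\lhd\mathscr G$ if $\varepsilon:\mathscr G\lhd\mathscr G$; $l\langle\varepsilon\rangle$ (resp. $r\langle\varepsilon\rangle$) $:\mathscr F_1\times\mathscr F_2\lhd\mathscr G$ if $\varepsilon:\mathscr F_1\lhd\mathscr G$ (resp. $\mathscr F_2$); $l[\varepsilon]$ (resp. $r[\varepsilon]$) $:\mathscr F_1\hat+\mathscr F_2\lhd\mathscr G$ if $\varepsilon:\mathscr F_1\lhd\mathscr G$ (resp. $\mathscr F_2$); $a(\varepsilon):\mathscr F^A\lhd\mathscr G$ if $\varepsilon:\mathscr F\lhd\mathscr G$; $\{\varepsilon\}:\mathcal P_\omega\mathscr F\lhd\mathscr G$ if $\varepsilon:\mathscr F\lhd\mathscr G$. $\mathsf{Exp}_{\mathscr G}$ is the set of closed expressions of type $\mathscr G\lhd\mathscr G$. Algebraic setting: $\mathcal E_{\mathscr G}$ is an equational specification whose terms include expressions (sort $\mathsf{Exp}$)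 and structured expressions $\sigma::=\varepsilon\mid b\mid\langle\sigma,\sigma\rangle\mid k_1(\sigma)\mid k_2(\sigma)\mid\bot\mid\top\mid\lambda.(a,\mathscr F\lhd\mathscr G,\sigma)\mid\{\sigma_1,\dots,\sigma_n\}$ (sort $\mathsf{ExpStruct}$; $\lambda.(a,\mathscr F\lhd\mathscr G,\sigma)$ denotes the function $A\to\mathscr F(\mathsf{Exp}_{\mathscr G})$ sending $a$ to $\sigma$ and every other letter to the empty structured expression of type $\mathscr F$), and whose equations define semilattice joins, substitution, typing and the coalgebra map on expressions; these equations serve only to reduce defined operations, and elements of $\mathscr F(\mathsf{Exp}_{\mathscr G})$ are identified with the corresponding reduced structured-expression terms (elements of $Id(\mathsf{Exp}_{\mathscr G})$ are expressions, of $\mathsf B$ semilattice constants, of products pairs, of $\hat+$ the terms $k_1(\sigma),k_2(\sigma),\bot,\top$, of $\mathcal P_\omega$ finite sets). A fresh sort $\mathsf{Frozen}$ and a freezing operator $\langle-\rangle:s\to\mathsf{Frozen}$ for each sort $s$ are added (no other operations take arguments of sort $\mathsf{Frozen}$). For $\mathcal R\subseteq\mathsf{Exp}_{\mathscr G}\times\mathsf{Exp}_{\mathscr G}$, $\mathcal E_{\mathscr G}\cup\langle\mathcal R\rangle$ denotes $\mathcal E_{\mathscr G}$ with the extra equations $\langle\varepsilon\rangle=\langle\varepsilon'\rangle$ for $(\varepsilon,\varepsilon')\in\mathcal R$. $\vdash$ is ordinary equational deduction (reflexivity, symmetry, transitivity, congruence, substitutivity), and $\vdash_{NDF}$ is $\vdash$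 extended with the rules: from $\langle\sigma_1\rangle=\langle\sigma_1'\rangle$ and $\langle\sigma_2\rangle=\langle\sigma_2'\rangle$ infer $\langle\langle\sigma_1,\sigma_2\rangle\rangle=\langle\langle\sigma_1',\sigma_2'\rangle\rangle$; from $\langle\sigma\rangle=\langle\sigma'\rangle$ infer $\langle k_i(\sigma)\rangle=\langle k_i(\sigma')\rangle$ ($i=1,2$); from $\langle f(a)\rangle=\langle g(a)\rangle$ for all $a\in A$ infer $\langle f\rangle=\langle g\rangle$; from $\langle\sigma_{i_l}\rangle=\langle\sigma'_{j_l}\rangle$ ($l=1,\dots,k$) with $\{i_1,\dots,i_k\}=\{1,\dots,n\}$ and $\{j_1,\dots,j_k\}=\{1,\dots,m\}$ infer $\langle\{\sigma_1,\dots,\sigma_n\}\rangle=\langle\{\sigma_1',\dots,\sigma_m'\}\rangle$. $\mathcal R_{id}=\mathcal R\cup\{(\varepsilon,\varepsilon)\mid\varepsilon\in\mathsf{Exp}_{\mathscr G}\}$, and $cl(\cdot)$ denotes the reflexive, symmetric, transitive closure. *)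

theory Defs
  imports "HOL-Library.Finite_Map"
begin

section \<open>Non-deterministic functors\<close>

text \<open>
  The elements of all semilattices are drawn from one type \<open>'b\<close> and the letters of all
  exponents from one type \<open>'a\<close>; different occurrences in a functor may use different
  semilattices and different (finite, possibly empty) alphabets.
  Of \<^term>\<open>j\<close> in \<open>Slat C j b\<close> only the restriction to \<open>C\<close> matters.
\<close>

datatype 'b slat =
  Slat (slat_carrier: "'b set") (slat_join: "'b \<Rightarrow> 'b \<Rightarrow> 'b") (slat_bot: 'b)

definition finite_join_semilattice :: "'b slat \<Rightarrow> bool" where
  "finite_join_semilattice B \<longleftrightarrow>
     finite (slat_carrier B) \<and> slat_bot B \<in> slat_carrier B \<and>
     (\<forall>x\<in>slat_carrier B. \<forall>y\<in>slat_carrier B. slat_join B x y \<in> slat_carrier B) \<and>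
     (\<forall>x\<in>slat_carrier B. \<forall>y\<in>slat_carrier B. \<forall>z\<in>slat_carrier B.
        slat_join B (slat_join B x y) z = slat_join B x (slat_join B y z)) \<and>
     (\<forall>x\<in>slat_carrier B. \<forall>y\<in>slat_carrier B. slat_join B x y = slat_join B y x) \<and>
     (\<forall>x\<in>slat_carrier B. slat_join B x x = x) \<and>
     (\<forall>x\<in>slat_carrier B. slat_join B (slat_bot B) x = x)"

datatype ('a, 'b) func =
    FId
  | FConst "'b slat"
  | FSum "('a, 'b) func" "('a, 'b) func"
  | FProd "('a, 'b) func" "('a, 'b) func"
  | FExpo "'a fset" "('a, 'b) func"
  | FPow "('a, 'b) func"

primrec nd_functor :: "('a, 'b) func \<Rightarrow> bool" where
  "nd_functor FId \<longleftrightarrow> True"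
| "nd_functor (FConst B) \<longleftrightarrow> finite_join_semilattice B"
| "nd_functor (FSum F1 F2) \<longleftrightarrow> nd_functor F1 \<and> nd_functor F2"
| "nd_functor (FProd F1 F2) \<longleftrightarrow> nd_functor F1 \<and> nd_functor F2"
| "nd_functor (FExpo A F) \<longleftrightarrow> nd_functor F"
| "nd_functor (FPow F) \<longleftrightarrow> nd_functor F"

definition constant_functor :: "('a, 'b) func \<Rightarrow> bool" where
  "constant_functor G \<longleftrightarrow> (\<exists>B. G = FConst B)"

inductive ingredient :: "('a, 'b) func \<Rightarrow> ('a, 'b) func \<Rightarrow> bool"  (infix \<open>\<lhd>\<^sub>F\<close> 50) where
  ing_refl: "F \<lhd>\<^sub>F F"
| ing_trans: "F1 \<lhd>\<^sub>F F2 \<Longrightarrow> F2 \<lhd>\<^sub>F F3 \<Longrightarrow> F1 \<lhd>\<^sub>F F3"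
| ing_prod1: "F1 \<lhd>\<^sub>F FProd F1 F2"
| ing_prod2: "F2 \<lhd>\<^sub>F FProd F1 F2"
| ing_sum1: "F1 \<lhd>\<^sub>F FSum F1 F2"
| ing_sum2: "F2 \<lhd>\<^sub>F FSum F1 F2"
| ing_expo: "F \<lhd>\<^sub>F FExpo A F"
| ing_pow: "F \<lhd>\<^sub>F FPow F"


section \<open>The action of functors on sets, functions and relations\<close>

text \<open>
  \<open>('a, 'b, 'x) elt\<close> is a universe for the elements of \<open>F(X)\<close>, where \<open>X\<close> is a set of values
  of type \<open>'x\<close>; a function with domain \<open>A\<close> is a finite map with domain \<open>A\<close>.  For every
  functor \<open>F\<close>, the function \<open>F(f)\<close> is the restriction of \<^term>\<open>map_elt f\<close> to \<open>F(X)\<close>.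
\<close>

datatype (dead 'a, dead 'b, 'x) elt =
    SId 'x
  | SConst 'b
  | SPair "('a, 'b, 'x) elt" "('a, 'b, 'x) elt"
  | SK1 "('a, 'b, 'x) elt"
  | SK2 "('a, 'b, 'x) elt"
  | SBot
  | STop
  | SFun "('a, ('a, 'b, 'x) elt) fmap"
  | SSet "('a, 'b, 'x) elt fset"

primrec fobj :: "('a, 'b) func \<Rightarrow> 'x set \<Rightarrow> ('a, 'b, 'x) elt set" where
  "fobj FId X = SId ` X"
| "fobj (FConst B) X = SConst ` slat_carrier B"
| "fobj (FSum F1 F2) X = SK1 ` fobj F1 X \<union> SK2 ` fobj F2 X \<union> {SBot, STop}"
| "fobj (FProd F1 F2) X = {SPair u v |u v. u \<in> fobj F1 X \<and> v \<in> fobj F2 X}"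
| "fobj (FExpo A F) X = {SFun m |m. fmdom m = A \<and> fmran' m \<subseteq> fobj F X}"
| "fobj (FPow F) X = {SSet U |U. fset U \<subseteq> fobj F X}"

definition lifting ::
  "('a, 'b) func \<Rightarrow> ('x \<times> 'x) set \<Rightarrow> (('a, 'b, 'x) elt \<times> ('a, 'b, 'x) elt) set" where
  "lifting F R = {(map_elt fst z, map_elt snd z) |z. z \<in> fobj F R}"

text \<open>The reflexive (on \<open>X\<close>), symmetric and transitive closure of \<open>R \<subseteq> X \<times> X\<close>.\<close>

definition cl_on :: "'x set \<Rightarrow> ('x \<times> 'x) set \<Rightarrow> ('x \<times> 'x) set" where
  "cl_on X R = Id_on X \<union> (R \<union> R\<inverse>)\<^sup>+"


section \<open>Expressions\<close>

text \<open>\<open>ELProd\<close>, \<open>ERProd\<close> are \<open>l\<langle>-\<rangle>\<close>, \<open>r\<langle>-\<rangle>\<close>, and \<open>ELSum\<close>, \<open>ERSum\<close> are \<open>l[-]\<close>, \<open>r[-]\<close>.\<close>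

datatype ('a, 'b) expr =
    EEmpty
  | EVar nat
  | EPlus "('a, 'b) expr" "('a, 'b) expr"
  | EMu nat "('a, 'b) expr"
  | EConst 'b
  | ELProd "('a, 'b) expr"
  | ERProd "('a, 'b) expr"
  | ELSum "('a, 'b) expr"
  | ERSum "('a, 'b) expr"
  | EAct 'a "('a, 'b) expr"
  | ESing "('a, 'b) expr"

text \<open>The two syntactic categories \<open>\<epsilon>\<close> and \<open>\<gamma>\<close> (the bodies allowed below \<open>\<mu>\<close>).\<close>

inductive expression :: "('a, 'b) expr \<Rightarrow> bool"
  and guarded :: "('a, 'b) expr \<Rightarrow> bool" where
  "expression (EVar x)"
| "expression e1 \<Longrightarrow> expression e2 \<Longrightarrow> expression (EPlus e1 e2)"
| "guarded e \<Longrightarrow> expression e"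
| "guarded EEmpty"
| "guarded e1 \<Longrightarrow> guarded e2 \<Longrightarrow> guarded (EPlus e1 e2)"
| "guarded e \<Longrightarrow> guarded (EMu x e)"
| "guarded (EConst b)"
| "expression e \<Longrightarrow> guarded (ELProd e)"
| "expression e \<Longrightarrow> guarded (ERProd e)"
| "expression e \<Longrightarrow> guarded (ELSum e)"
| "expression e \<Longrightarrow> guarded (ERSum e)"
| "expression e \<Longrightarrow> guarded (EAct a e)"
| "expression e \<Longrightarrow> guarded (ESing e)"

primrec free_vars :: "('a, 'b) expr \<Rightarrow> nat set" where
  "free_vars EEmpty = {}"
| "free_vars (EVar x) = {x}"
| "free_vars (EPlus e1 e2) = free_vars e1 \<union> free_vars e2"
| "free_vars (EMu x e) = free_vars e - {x}"
| "free_vars (EConst b) = {}"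
| "free_vars (ELProd e) = free_vars e"
| "free_vars (ERProd e) = free_vars e"
| "free_vars (ELSum e) = free_vars e"
| "free_vars (ERSum e) = free_vars e"
| "free_vars (EAct a e) = free_vars e"
| "free_vars (ESing e) = free_vars e"

text \<open>
  \<open>typed G e F\<close> is the judgement \<open>\<turnstile> e : F \<lhd> G\<close>.  The premises on ingredients reflect that
  the judgement only makes sense for ingredients \<open>F\<close> of \<open>G\<close>.
\<close>

inductive typed :: "('a, 'b) func \<Rightarrow> ('a, 'b) expr \<Rightarrow> ('a, 'b) func \<Rightarrow> bool" for G where
  "F \<lhd>\<^sub>F G \<Longrightarrow> typed G EEmpty F"
| "FConst B \<lhd>\<^sub>F G \<Longrightarrow> b \<in> slat_carrier B \<Longrightarrow> typed G (EConst b) (FConst B)"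
| "typed G (EVar x) G"
| "typed G e G \<Longrightarrow> typed G (EMu x e) G"
| "typed G e1 F \<Longrightarrow> typed G e2 F \<Longrightarrow> typed G (EPlus e1 e2) F"
| "FId \<lhd>\<^sub>F G \<Longrightarrow> typed G e G \<Longrightarrow> typed G e FId"
| "FProd F1 F2 \<lhd>\<^sub>F G \<Longrightarrow> typed G e F1 \<Longrightarrow> typed G (ELProd e) (FProd F1 F2)"
| "FProd F1 F2 \<lhd>\<^sub>F G \<Longrightarrow> typed G e F2 \<Longrightarrow> typed G (ERProd e) (FProd F1 F2)"
| "FSum F1 F2 \<lhd>\<^sub>F G \<Longrightarrow> typed G e F1 \<Longrightarrow> typed G (ELSum e) (FSum F1 F2)"
| "FSum F1 F2 \<lhd>\<^sub>F G \<Longrightarrow> typed G e F2 \<Longrightarrow> typed G (ERSum e) (FSum F1 F2)"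
| "FExpo A F \<lhd>\<^sub>F G \<Longrightarrow> a |\<in>| A \<Longrightarrow> typed G e F \<Longrightarrow> typed G (EAct a e) (FExpo A F)"
| "FPow F \<lhd>\<^sub>F G \<Longrightarrow> typed G e F \<Longrightarrow> typed G (ESing e) (FPow F)"

definition Exprs :: "('a, 'b) func \<Rightarrow> ('a, 'b) expr set" where
  "Exprs G = {e. expression e \<and> free_vars e = {} \<and> typed G e G}"


section \<open>The signature of the specification\<close>

text \<open>
  The specification is order-sorted: semilattice constants are guarded expressions, guarded
  expressions are expressions, and expressions are structured expressions.
\<close>

datatype srt = Slt | GExp | Exp | ExpStruct | Bool | Frozen

inductive subsort :: "srt \<Rightarrow> srt \<Rightarrow> bool" where
  "subsort s s"
| "subsort s1 s2 \<Longrightarrow> subsort s2 s3 \<Longrightarrow> subsort s1 s3"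
| "subsort Slt GExp"
| "subsort GExp Exp"
| "subsort Exp ExpStruct"

text \<open>
  Fixed-point variables, letters, semilattices and functors are not terms but indices of
  operators.  As \<open>G\<close> is fixed in its specification, an ingredient \<open>F \<lhd> G\<close> is written \<open>F\<close>.
  Besides the constructors of (structured) expressions and Booleans there are the defined
  operators \<open>OJoin\<close>, \<open>OSubst\<close> (with \<open>Op (OSubst x) [t, u]\<close> for \<open>t[u/x]\<close>), \<open>OCheck F\<close>
  (the type check \<open>- : F \<lhd> G\<close>), \<open>OEmptySt F\<close> (the empty structured expression), \<open>OPlusSt F\<close>
  (the sum of structured expressions), \<open>ODelta F\<close> (the coalgebra map), \<open>OLam A F a\<close> (for
  \<open>\<lambda>.(a, F \<lhd> G, -)\<close> with codomain \<open>F(Exprs G)\<close> and domain \<open>A\<close>) and conjunction,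
  and the freezing operator \<open>OFreeze\<close>.
\<close>

datatype ('a, 'b) opr =
    OEmpty | OVar nat | OPlus | OMu nat | OConst 'b
  | OLProd | ORProd | OLSum | ORSum | OAct 'a | OSing
  | OPair | OK1 | OK2 | OBot | OTop
  | OTrue | OFalse
  | OJoin "'b slat" | OSubst nat | OCheck "('a, 'b) func" | OAnd
  | OEmptySt "('a, 'b) func" | OPlusSt "('a, 'b) func" | ODelta "('a, 'b) func"
  | OLam "'a fset" "('a, 'b) func" 'a
  | OFreeze

inductive has_rank :: "('a, 'b) func \<Rightarrow> ('a, 'b) opr \<Rightarrow> srt list \<Rightarrow> srt \<Rightarrow> bool" for G where
  "has_rank G OEmpty [] GExp"
| "has_rank G (OVar x) [] Exp"
| "has_rank G OPlus [Exp, Exp] Exp"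
| "has_rank G OPlus [GExp, GExp] GExp"
| "has_rank G (OMu x) [GExp] GExp"
| "has_rank G (OConst b) [] Slt"
| "has_rank G OLProd [Exp] GExp"
| "has_rank G ORProd [Exp] GExp"
| "has_rank G OLSum [Exp] GExp"
| "has_rank G ORSum [Exp] GExp"
| "has_rank G (OAct a) [Exp] GExp"
| "has_rank G OSing [Exp] GExp"
| "has_rank G OPair [ExpStruct, ExpStruct] ExpStruct"
| "has_rank G OK1 [ExpStruct] ExpStruct"
| "has_rank G OK2 [ExpStruct] ExpStruct"
| "has_rank G OBot [] ExpStruct"
| "has_rank G OTop [] ExpStruct"
| "has_rank G OTrue [] Bool"
| "has_rank G OFalse [] Bool"
| "FConst B \<lhd>\<^sub>F G \<Longrightarrow> has_rank G (OJoin B) [Slt, Slt] Slt"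
| "has_rank G (OSubst x) [Exp, Exp] Exp"
| "has_rank G (OSubst x) [GExp, Exp] GExp"
| "F \<lhd>\<^sub>F G \<Longrightarrow> has_rank G (OCheck F) [Exp] Bool"
| "has_rank G OAnd [Bool, Bool] Bool"
| "F \<lhd>\<^sub>F G \<Longrightarrow> has_rank G (OEmptySt F) [] ExpStruct"
| "F \<lhd>\<^sub>F G \<Longrightarrow> has_rank G (OPlusSt F) [ExpStruct, ExpStruct] ExpStruct"
| "F \<lhd>\<^sub>F G \<Longrightarrow> has_rank G (ODelta F) [Exp] ExpStruct"
| "FExpo A F \<lhd>\<^sub>F G \<Longrightarrow> a |\<in>| A \<Longrightarrow> has_rank G (OLam A F a) [ExpStruct] ExpStruct"
| "s \<noteq> Frozen \<Longrightarrow> has_rank G OFreeze [s] Frozen"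

text \<open>
  \<open>TSet {|t1, \<dots>, tn|}\<close> is the term \<open>{t1, \<dots>, tn}\<close>.  \<open>TFun m\<close> is the reduced term of an
  arbitrary function with finite domain \<^term>\<open>fmdom m\<close>.
\<close>

datatype ('a, 'b) trm =
    V srt nat
  | Op "('a, 'b) opr" "('a, 'b) trm list"
  | TFun "('a, ('a, 'b) trm) fmap"
  | TSet "('a, 'b) trm fset"

inductive has_sort :: "('a, 'b) func \<Rightarrow> ('a, 'b) trm \<Rightarrow> srt \<Rightarrow> bool" for G where
  "has_sort G (V s n) s"
| "has_rank G f ss s \<Longrightarrow> list_all2 (has_sort G) ts ss \<Longrightarrow> has_sort G (Op f ts) s"
| "\<forall>t\<in>fmran' m. has_sort G t ExpStruct \<Longrightarrow> has_sort G (TFun m) ExpStruct"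
| "\<forall>t\<in>fset U. has_sort G t ExpStruct \<Longrightarrow> has_sort G (TSet U) ExpStruct"
| "has_sort G t s \<Longrightarrow> subsort s s' \<Longrightarrow> has_sort G t s'"

definition well_sorted :: "('a, 'b) func \<Rightarrow> ('a, 'b) trm \<Rightarrow> bool" where
  "well_sorted G t \<longleftrightarrow> (\<exists>s. has_sort G t s)"

primrec inst :: "(srt \<Rightarrow> nat \<Rightarrow> ('a, 'b) trm) \<Rightarrow> ('a, 'b) trm \<Rightarrow> ('a, 'b) trm" where
  "inst \<theta> (V s n) = \<theta> s n"
| "inst \<theta> (Op f ts) = Op f (map (inst \<theta>) ts)"
| "inst \<theta> (TFun m) = TFun (fmmap (inst \<theta>) m)"
| "inst \<theta> (TSet U) = TSet (inst \<theta> |`| U)"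

primrec expr_trm :: "('a, 'b) expr \<Rightarrow> ('a, 'b) trm" where
  "expr_trm EEmpty = Op OEmpty []"
| "expr_trm (EVar x) = Op (OVar x) []"
| "expr_trm (EPlus e1 e2) = Op OPlus [expr_trm e1, expr_trm e2]"
| "expr_trm (EMu x e) = Op (OMu x) [expr_trm e]"
| "expr_trm (EConst b) = Op (OConst b) []"
| "expr_trm (ELProd e) = Op OLProd [expr_trm e]"
| "expr_trm (ERProd e) = Op ORProd [expr_trm e]"
| "expr_trm (ELSum e) = Op OLSum [expr_trm e]"
| "expr_trm (ERSum e) = Op ORSum [expr_trm e]"
| "expr_trm (EAct a e) = Op (OAct a) [expr_trm e]"
| "expr_trm (ESing e) = Op OSing [expr_trm e]"

text \<open>The reduced structured-expression term with which an element of \<open>F(Exprs G)\<close> is identified.\<close>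

primrec elt_trm :: "('a, 'b, ('a, 'b) expr) elt \<Rightarrow> ('a, 'b) trm" where
  "elt_trm (SId e) = expr_trm e"
| "elt_trm (SConst b) = Op (OConst b) []"
| "elt_trm (SPair u v) = Op OPair [elt_trm u, elt_trm v]"
| "elt_trm (SK1 u) = Op OK1 [elt_trm u]"
| "elt_trm (SK2 u) = Op OK2 [elt_trm u]"
| "elt_trm SBot = Op OBot []"
| "elt_trm STop = Op OTop []"
| "elt_trm (SFun m) = TFun (fmmap elt_trm m)"
| "elt_trm (SSet U) = TSet (elt_trm |`| U)"


section \<open>The equations of the specification\<close>

context includes fmap.lifting
begin

lift_definition tabulate :: "'a fset \<Rightarrow> ('a \<Rightarrow> 'c) \<Rightarrow> ('a, 'c) fmap" is
  "\<lambda>A h a. if a |\<in>| A then Some (h a) else None"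
  by (rule finite_subset[OF _ finite_fset]) (auto simp: dom_def)

lemma fmlookup_tabulate [simp]:
  "fmlookup (tabulate A h) a = (if a |\<in>| A then Some (h a) else None)"
  by transfer simp

end

abbreviation "gX n \<equiv> V GExp n"
abbreviation "eX n \<equiv> V Exp n"
abbreviation "sX n \<equiv> V ExpStruct n"

text \<open>
  The equations for sums of functions and of finite sets are schemes, with arbitrary (well-sorted)
  argument terms.  Substitution is the purely structural one; the coalgebra map applies it
  only to replace a variable by an expression \<open>\<mu>x.\<gamma>\<close>, so that no variable is captured when
  it unfolds closed expressions.  The typing rule \<open>e : Id \<lhd> G\<close> if \<open>e : G \<lhd> G\<close> and the clause
  \<open>\<delta>\<^bsub>Id \<lhd> G\<^esub>(e) = e\<close> are oriented equations only for \<open>G \<noteq> Id\<close>.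
\<close>

inductive spec_eq :: "('a, 'b) func \<Rightarrow> ('a, 'b) trm \<Rightarrow> ('a, 'b) trm \<Rightarrow> bool" for G where
  join: "b \<in> slat_carrier B \<Longrightarrow> c \<in> slat_carrier B \<Longrightarrow>
    spec_eq G (Op (OJoin B) [Op (OConst b) [], Op (OConst c) []])
              (Op (OConst (slat_join B b c)) [])"

| subst_empty: "spec_eq G (Op (OSubst x) [Op OEmpty [], eX 0]) (Op OEmpty [])"
| subst_var_eq: "spec_eq G (Op (OSubst x) [Op (OVar x) [], eX 0]) (eX 0)"
| subst_var_neq: "y \<noteq> x \<Longrightarrow>
    spec_eq G (Op (OSubst x) [Op (OVar y) [], eX 0]) (Op (OVar y) [])"
| subst_plus: "spec_eq G (Op (OSubst x) [Op OPlus [eX 1, eX 2], eX 0])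
    (Op OPlus [Op (OSubst x) [eX 1, eX 0], Op (OSubst x) [eX 2, eX 0]])"
| subst_mu_eq: "spec_eq G (Op (OSubst x) [Op (OMu x) [gX 1], eX 0]) (Op (OMu x) [gX 1])"
| subst_mu_neq: "y \<noteq> x \<Longrightarrow> spec_eq G (Op (OSubst x) [Op (OMu y) [gX 1], eX 0])
    (Op (OMu y) [Op (OSubst x) [gX 1, eX 0]])"
| subst_const: "spec_eq G (Op (OSubst x) [Op (OConst b) [], eX 0]) (Op (OConst b) [])"
| subst_lprod: "spec_eq G (Op (OSubst x) [Op OLProd [eX 1], eX 0])
    (Op OLProd [Op (OSubst x) [eX 1, eX 0]])"
| subst_rprod: "spec_eq G (Op (OSubst x) [Op ORProd [eX 1], eX 0])
    (Op ORProd [Op (OSubst x) [eX 1, eX 0]])"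
| subst_lsum: "spec_eq G (Op (OSubst x) [Op OLSum [eX 1], eX 0])
    (Op OLSum [Op (OSubst x) [eX 1, eX 0]])"
| subst_rsum: "spec_eq G (Op (OSubst x) [Op ORSum [eX 1], eX 0])
    (Op ORSum [Op (OSubst x) [eX 1, eX 0]])"
| subst_act: "spec_eq G (Op (OSubst x) [Op (OAct a) [eX 1], eX 0])
    (Op (OAct a) [Op (OSubst x) [eX 1, eX 0]])"
| subst_sing: "spec_eq G (Op (OSubst x) [Op OSing [eX 1], eX 0])
    (Op OSing [Op (OSubst x) [eX 1, eX 0]])"

| and_true: "spec_eq G (Op OAnd [Op OTrue [], V Bool 0]) (V Bool 0)"
| and_false: "spec_eq G (Op OAnd [Op OFalse [], V Bool 0]) (Op OFalse [])"

| check_empty: "spec_eq G (Op (OCheck F) [Op OEmpty []]) (Op OTrue [])"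
| check_plus: "spec_eq G (Op (OCheck F) [Op OPlus [eX 0, eX 1]])
    (Op OAnd [Op (OCheck F) [eX 0], Op (OCheck F) [eX 1]])"
| check_id: "G \<noteq> FId \<Longrightarrow> spec_eq G (Op (OCheck FId) [eX 0]) (Op (OCheck G) [eX 0])"
| check_var: "spec_eq G (Op (OCheck G) [Op (OVar x) []]) (Op OTrue [])"
| check_mu: "spec_eq G (Op (OCheck G) [Op (OMu x) [gX 0]]) (Op (OCheck G) [gX 0])"
| check_const: "b \<in> slat_carrier B \<Longrightarrow>
    spec_eq G (Op (OCheck (FConst B)) [Op (OConst b) []]) (Op OTrue [])"
| check_lprod: "spec_eq G (Op (OCheck (FProd F1 F2)) [Op OLProd [eX 0]]) (Op (OCheck F1) [eX 0])"
| check_rprod: "spec_eq G (Op (OCheck (FProd F1 F2)) [Op ORProd [eX 0]]) (Op (OCheck F2) [eX 0])"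
| check_lsum: "spec_eq G (Op (OCheck (FSum F1 F2)) [Op OLSum [eX 0]]) (Op (OCheck F1) [eX 0])"
| check_rsum: "spec_eq G (Op (OCheck (FSum F1 F2)) [Op ORSum [eX 0]]) (Op (OCheck F2) [eX 0])"
| check_act: "a |\<in>| A \<Longrightarrow>
    spec_eq G (Op (OCheck (FExpo A F)) [Op (OAct a) [eX 0]]) (Op (OCheck F) [eX 0])"
| check_sing: "spec_eq G (Op (OCheck (FPow F)) [Op OSing [eX 0]]) (Op (OCheck F) [eX 0])"
| check_var_false: "F \<noteq> FId \<Longrightarrow> F \<noteq> G \<Longrightarrow>
    spec_eq G (Op (OCheck F) [Op (OVar x) []]) (Op OFalse [])"
| check_mu_false: "F \<noteq> FId \<Longrightarrow> F \<noteq> G \<Longrightarrow>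
    spec_eq G (Op (OCheck F) [Op (OMu x) [gX 0]]) (Op OFalse [])"
| check_const_false: "F \<noteq> FId \<or> G = FId \<Longrightarrow> \<nexists>B. F = FConst B \<and> b \<in> slat_carrier B \<Longrightarrow>
    spec_eq G (Op (OCheck F) [Op (OConst b) []]) (Op OFalse [])"
| check_lprod_false: "F \<noteq> FId \<or> G = FId \<Longrightarrow> \<nexists>F1 F2. F = FProd F1 F2 \<Longrightarrow>
    spec_eq G (Op (OCheck F) [Op OLProd [eX 0]]) (Op OFalse [])"
| check_rprod_false: "F \<noteq> FId \<or> G = FId \<Longrightarrow> \<nexists>F1 F2. F = FProd F1 F2 \<Longrightarrow>
    spec_eq G (Op (OCheck F) [Op ORProd [eX 0]]) (Op OFalse [])"
| check_lsum_false: "F \<noteq> FId \<or> G = FId \<Longrightarrow> \<nexists>F1 F2. F = FSum F1 F2 \<Longrightarrow>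
    spec_eq G (Op (OCheck F) [Op OLSum [eX 0]]) (Op OFalse [])"
| check_rsum_false: "F \<noteq> FId \<or> G = FId \<Longrightarrow> \<nexists>F1 F2. F = FSum F1 F2 \<Longrightarrow>
    spec_eq G (Op (OCheck F) [Op ORSum [eX 0]]) (Op OFalse [])"
| check_act_false: "F \<noteq> FId \<or> G = FId \<Longrightarrow> \<nexists>A F'. F = FExpo A F' \<and> a |\<in>| A \<Longrightarrow>
    spec_eq G (Op (OCheck F) [Op (OAct a) [eX 0]]) (Op OFalse [])"
| check_sing_false: "F \<noteq> FId \<or> G = FId \<Longrightarrow> \<nexists>F'. F = FPow F' \<Longrightarrow>
    spec_eq G (Op (OCheck F) [Op OSing [eX 0]]) (Op OFalse [])"

| empty_id: "spec_eq G (Op (OEmptySt FId) []) (Op OEmpty [])"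
| empty_const: "spec_eq G (Op (OEmptySt (FConst B)) []) (Op (OConst (slat_bot B)) [])"
| empty_prod: "spec_eq G (Op (OEmptySt (FProd F1 F2)) [])
    (Op OPair [Op (OEmptySt F1) [], Op (OEmptySt F2) []])"
| empty_sum: "spec_eq G (Op (OEmptySt (FSum F1 F2)) []) (Op OBot [])"
| empty_expo: "spec_eq G (Op (OEmptySt (FExpo A F)) []) (TFun (tabulate A (\<lambda>a. Op (OEmptySt F) [])))"
| empty_pow: "spec_eq G (Op (OEmptySt (FPow F)) []) (TSet {||})"

| lam: "spec_eq G (Op (OLam A F a) [sX 0])
    (TFun (tabulate A (\<lambda>a'. if a' = a then sX 0 else Op (OEmptySt F) [])))"

| plus_id: "spec_eq G (Op (OPlusSt FId) [eX 0, eX 1]) (Op OPlus [eX 0, eX 1])"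
| plus_const: "spec_eq G (Op (OPlusSt (FConst B)) [V Slt 0, V Slt 1])
    (Op (OJoin B) [V Slt 0, V Slt 1])"
| plus_prod: "spec_eq G (Op (OPlusSt (FProd F1 F2)) [Op OPair [sX 0, sX 1], Op OPair [sX 2, sX 3]])
    (Op OPair [Op (OPlusSt F1) [sX 0, sX 2], Op (OPlusSt F2) [sX 1, sX 3]])"
| plus_sum_11: "spec_eq G (Op (OPlusSt (FSum F1 F2)) [Op OK1 [sX 0], Op OK1 [sX 1]])
    (Op OK1 [Op (OPlusSt F1) [sX 0, sX 1]])"
| plus_sum_22: "spec_eq G (Op (OPlusSt (FSum F1 F2)) [Op OK2 [sX 0], Op OK2 [sX 1]])
    (Op OK2 [Op (OPlusSt F2) [sX 0, sX 1]])"
| plus_sum_12: "spec_eq G (Op (OPlusSt (FSum F1 F2)) [Op OK1 [sX 0], Op OK2 [sX 1]]) (Op OTop [])"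
| plus_sum_21: "spec_eq G (Op (OPlusSt (FSum F1 F2)) [Op OK2 [sX 0], Op OK1 [sX 1]]) (Op OTop [])"
| plus_sum_bot_l: "spec_eq G (Op (OPlusSt (FSum F1 F2)) [Op OBot [], sX 0]) (sX 0)"
| plus_sum_bot_r: "spec_eq G (Op (OPlusSt (FSum F1 F2)) [sX 0, Op OBot []]) (sX 0)"
| plus_sum_top_l: "spec_eq G (Op (OPlusSt (FSum F1 F2)) [Op OTop [], sX 0]) (Op OTop [])"
| plus_sum_top_r: "spec_eq G (Op (OPlusSt (FSum F1 F2)) [sX 0, Op OTop []]) (Op OTop [])"
| plus_expo: "fmdom m1 = A \<Longrightarrow> fmdom m2 = A \<Longrightarrow>
    spec_eq G (Op (OPlusSt (FExpo A F)) [TFun m1, TFun m2])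
    (TFun (tabulate A (\<lambda>a. Op (OPlusSt F) [the (fmlookup m1 a), the (fmlookup m2 a)])))"
| plus_pow: "spec_eq G (Op (OPlusSt (FPow F)) [TSet U1, TSet U2]) (TSet (U1 |\<union>| U2))"

| delta_empty: "spec_eq G (Op (ODelta F) [Op OEmpty []]) (Op (OEmptySt F) [])"
| delta_plus: "spec_eq G (Op (ODelta F) [Op OPlus [eX 0, eX 1]])
    (Op (OPlusSt F) [Op (ODelta F) [eX 0], Op (ODelta F) [eX 1]])"
| delta_mu: "spec_eq G (Op (ODelta G) [Op (OMu x) [gX 0]])
    (Op (ODelta G) [Op (OSubst x) [gX 0, Op (OMu x) [gX 0]]])"
| delta_id: "G \<noteq> FId \<Longrightarrow> spec_eq G (Op (ODelta FId) [eX 0]) (eX 0)"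
| delta_const: "b \<in> slat_carrier B \<Longrightarrow>
    spec_eq G (Op (ODelta (FConst B)) [Op (OConst b) []]) (Op (OConst b) [])"
| delta_lprod: "spec_eq G (Op (ODelta (FProd F1 F2)) [Op OLProd [eX 0]])
    (Op OPair [Op (ODelta F1) [eX 0], Op (OEmptySt F2) []])"
| delta_rprod: "spec_eq G (Op (ODelta (FProd F1 F2)) [Op ORProd [eX 0]])
    (Op OPair [Op (OEmptySt F1) [], Op (ODelta F2) [eX 0]])"
| delta_lsum: "spec_eq G (Op (ODelta (FSum F1 F2)) [Op OLSum [eX 0]])
    (Op OK1 [Op (ODelta F1) [eX 0]])"
| delta_rsum: "spec_eq G (Op (ODelta (FSum F1 F2)) [Op ORSum [eX 0]])
    (Op OK2 [Op (ODelta F2) [eX 0]])"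
| delta_act: "a |\<in>| A \<Longrightarrow> spec_eq G (Op (ODelta (FExpo A F)) [Op (OAct a) [eX 0]])
    (Op (OLam A F a) [Op (ODelta F) [eX 0]])"
| delta_sing: "spec_eq G (Op (ODelta (FPow F)) [Op OSing [eX 0]]) (TSet {|Op (ODelta F) [eX 0]|})"

definition spec :: "('a, 'b) func \<Rightarrow> (('a, 'b) trm \<times> ('a, 'b) trm) set" where
  "spec G = {(t, u). spec_eq G t u \<and> well_sorted G t \<and> well_sorted G u}"

abbreviation frz :: "('a, 'b) trm \<Rightarrow> ('a, 'b) trm" where
  "frz t \<equiv> Op OFreeze [t]"

definition frozen_eqs :: "(('a, 'b) expr \<times> ('a, 'b) expr) set \<Rightarrow> (('a, 'b) trm \<times> ('a, 'b) trm) set"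
  where "frozen_eqs R = {(frz (expr_trm e), frz (expr_trm e')) |e e'. (e, e') \<in> R}"


section \<open>Deduction\<close>

text \<open>
  Rules \<open>axiom\<close> to \<open>congr_set\<close> are those of equational deduction, relative to the signature
  for \<open>G\<close> and a set \<open>E\<close> of equations; the remaining ones act on frozen terms.  In \<open>congr_set\<close>
  and \<open>ndf_set\<close> the list \<open>ps\<close> enumerates the pairs \<open>(\<sigma>\<^bsub>i_l\<^esub>, \<sigma>'\<^bsub>j_l\<^esub>)\<close>, \<open>l = 1, \<dots>, k\<close>.
  In \<open>ndf_fun\<close> the functions are reduced function terms, whose value at \<open>a\<close> is their entry at
  \<open>a\<close>; terms \<open>\<lambda>.(a, F \<lhd> G, \<sigma>)\<close> are equal to such terms by the specification.
\<close>

inductive ndf_ded :: "('a, 'b) func \<Rightarrow> (('a, 'b) trm \<times> ('a, 'b) trm) set \<Rightarrow>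
    ('a, 'b) trm \<Rightarrow> ('a, 'b) trm \<Rightarrow> bool" for G E where
  axiom: "(t, u) \<in> E \<Longrightarrow> ndf_ded G E t u"
| refl: "well_sorted G t \<Longrightarrow> ndf_ded G E t t"
| sym: "ndf_ded G E t u \<Longrightarrow> ndf_ded G E u t"
| trans: "ndf_ded G E t u \<Longrightarrow> ndf_ded G E u v \<Longrightarrow> ndf_ded G E t v"
| subst: "ndf_ded G E t u \<Longrightarrow> \<forall>s n. has_sort G (\<theta> s n) s \<Longrightarrow> ndf_ded G E (inst \<theta> t) (inst \<theta> u)"
| congr: "list_all2 (ndf_ded G E) ts us \<Longrightarrow> well_sorted G (Op f ts) \<Longrightarrow> well_sorted G (Op f us) \<Longrightarrow>
    ndf_ded G E (Op f ts) (Op f us)"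
| congr_fun: "fmdom m1 = A \<Longrightarrow> fmdom m2 = A \<Longrightarrow>
    \<forall>a. a |\<in>| A \<longrightarrow> ndf_ded G E (the (fmlookup m1 a)) (the (fmlookup m2 a)) \<Longrightarrow>
    well_sorted G (TFun m1) \<Longrightarrow> well_sorted G (TFun m2) \<Longrightarrow> ndf_ded G E (TFun m1) (TFun m2)"
| congr_set: "\<forall>(t, u) \<in> set ps. ndf_ded G E t u \<Longrightarrow>
    U1 = fset_of_list (map fst ps) \<Longrightarrow> U2 = fset_of_list (map snd ps) \<Longrightarrow>
    well_sorted G (TSet U1) \<Longrightarrow> well_sorted G (TSet U2) \<Longrightarrow> ndf_ded G E (TSet U1) (TSet U2)"

| ndf_pair: "ndf_ded G E (frz t1) (frz u1) \<Longrightarrow> ndf_ded G E (frz t2) (frz u2) \<Longrightarrow>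
    well_sorted G (Op OPair [t1, t2]) \<Longrightarrow> well_sorted G (Op OPair [u1, u2]) \<Longrightarrow>
    ndf_ded G E (frz (Op OPair [t1, t2])) (frz (Op OPair [u1, u2]))"
| ndf_k1: "ndf_ded G E (frz t) (frz u) \<Longrightarrow>
    well_sorted G (Op OK1 [t]) \<Longrightarrow> well_sorted G (Op OK1 [u]) \<Longrightarrow>
    ndf_ded G E (frz (Op OK1 [t])) (frz (Op OK1 [u]))"
| ndf_k2: "ndf_ded G E (frz t) (frz u) \<Longrightarrow>
    well_sorted G (Op OK2 [t]) \<Longrightarrow> well_sorted G (Op OK2 [u]) \<Longrightarrow>
    ndf_ded G E (frz (Op OK2 [t])) (frz (Op OK2 [u]))"
| ndf_fun: "fmdom m1 = A \<Longrightarrow> fmdom m2 = A \<Longrightarrow>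
    \<forall>a. a |\<in>| A \<longrightarrow> ndf_ded G E (frz (the (fmlookup m1 a))) (frz (the (fmlookup m2 a))) \<Longrightarrow>
    well_sorted G (TFun m1) \<Longrightarrow> well_sorted G (TFun m2) \<Longrightarrow>
    ndf_ded G E (frz (TFun m1)) (frz (TFun m2))"
| ndf_set: "\<forall>(t, u) \<in> set ps. ndf_ded G E (frz t) (frz u) \<Longrightarrow>
    U1 = fset_of_list (map fst ps) \<Longrightarrow> U2 = fset_of_list (map snd ps) \<Longrightarrow>
    well_sorted G (TSet U1) \<Longrightarrow> well_sorted G (TSet U2) \<Longrightarrow>
    ndf_ded G E (frz (TSet U1)) (frz (TSet U2))"

end

theory Submission
  imports Defs
begin

text \<open>
  Completeness is an induction on the functor.  For soundness, every term is evaluated in the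
  elements over \<^emph>\<open>expressions\<close>: a semilattice constant \<open>b\<close> is read as the expression \<open>b\<close>, the
  defined operators are computed, all Booleans are identified (no equation leads from Booleans back
  to expressions), and freezing replaces each expression by a chosen representative of its class
  under the equivalence generated by \<open>R\<close>.  This is a model of all equations and rules, and two
  elements of \<open>F(Exp)\<close> have equal frozen values iff they are related by the lifting of that
  equivalence.  Constants and expressions of type \<open>G\<close> cannot be confused, since a constant has
  type \<open>G\<close> only if \<open>G\<close> is a constant functor.
\<close>

section \<open>Evaluation of the defined operators\<close>

primrec esubst :: "nat \<Rightarrow> ('a, 'b) expr \<Rightarrow> ('a, 'b) expr \<Rightarrow> ('a, 'b) expr" where
  "esubst x u EEmpty = EEmpty"
| "esubst x u (EVar y) = (if y = x then u else EVar y)"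
| "esubst x u (EPlus e1 e2) = EPlus (esubst x u e1) (esubst x u e2)"
| "esubst x u (EMu y e) = EMu y (if y = x then e else esubst x u e)"
| "esubst x u (EConst b) = EConst b"
| "esubst x u (ELProd e) = ELProd (esubst x u e)"
| "esubst x u (ERProd e) = ERProd (esubst x u e)"
| "esubst x u (ELSum e) = ELSum (esubst x u e)"
| "esubst x u (ERSum e) = ERSum (esubst x u e)"
| "esubst x u (EAct a e) = EAct a (esubst x u e)"
| "esubst x u (ESing e) = ESing (esubst x u e)"

text \<open>These are the two ranks of \<open>OSubst\<close>. In a guarded expression every variable
  lies below a guarding constructor, so putting an arbitrary expression there keeps it
  guarded.\<close>

lemma esubst_sorts:
  assumes "expression u"
  shows "expression e \<Longrightarrow> expression (esubst x u e)"
    and "guarded e \<Longrightarrow> guarded (esubst x u e)"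
  by (induction e rule: expression_guarded.inducts)
     (auto intro: expression_guarded.intros assms)

text \<open>Counts the \<open>EPlus\<close> and \<open>EMu\<close> nodes above the first guard.
  These are the nodes that the coalgebra map passes without descending to a smaller functor.\<close>

primrec unguarded_size :: "('a, 'b) expr \<Rightarrow> nat" where
  "unguarded_size EEmpty = 0"
| "unguarded_size (EVar x) = 0"
| "unguarded_size (EPlus e1 e2) = Suc (unguarded_size e1 + unguarded_size e2)"
| "unguarded_size (EMu x e) = Suc (unguarded_size e)"
| "unguarded_size (EConst b) = 0"
| "unguarded_size (ELProd e) = 0"
| "unguarded_size (ERProd e) = 0"
| "unguarded_size (ELSum e) = 0"
| "unguarded_size (ERSum e) = 0"
| "unguarded_size (EAct a e) = 0"
| "unguarded_size (ESing e) = 0"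

text \<open>Substitution changes a guarded expression only below its guards, where nothing is
  counted. The trivial first claim serves the mutual induction.\<close>

lemma unguarded_size_esubst:
  "expression e \<Longrightarrow> True"
  "guarded e \<Longrightarrow> unguarded_size (esubst x u e) = unguarded_size e"
  by (induction e rule: expression_guarded.inducts) auto

type_synonym ('a, 'b) val = "('a, 'b, ('a, 'b) expr) elt"

text \<open>The bottom constant is a \<open>SId\<close> value because \<open>Slt\<close> is a
  subsort of \<open>Exp\<close>, whose values all have that form.\<close>

primrec empty_val :: "('a, 'b) func \<Rightarrow> ('a, 'b) val" where
  "empty_val FId = SId EEmpty"
| "empty_val (FConst B) = SId (EConst (slat_bot B))"
| "empty_val (FSum F1 F2) = SBot"
| "empty_val (FProd F1 F2) = SPair (empty_val F1) (empty_val F2)"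
| "empty_val (FExpo A F) = SFun (tabulate A (\<lambda>_. empty_val F))"
| "empty_val (FPow F) = SSet {||}"

fun val_expr :: "('a, 'b) val \<Rightarrow> ('a, 'b) expr" where
  "val_expr (SId e) = e"
| "val_expr _ = EEmpty"

fun val_const :: "('a, 'b) val \<Rightarrow> 'b" where
  "val_const (SId (EConst b)) = b"
| "val_const _ = undefined"

text \<open>Variables of sort \<open>ExpStruct\<close> will range over all values, junk included. In
  a sum, \<open>SBot\<close> must be neutral and \<open>STop\<close> absorbing even then; hence the
  tests for \<open>SBot\<close> come first and \<open>STop\<close> is the default.\<close>

primrec plus_val :: "('a, 'b) func \<Rightarrow> ('a, 'b) val \<Rightarrow> ('a, 'b) val \<Rightarrow> ('a, 'b) val" where
  "plus_val FId u v = SId (EPlus (val_expr u) (val_expr v))"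
| "plus_val (FConst B) u v = SId (EConst (slat_join B (val_const u) (val_const v)))"
| "plus_val (FSum F1 F2) u v =
    (if u = SBot then v else if v = SBot then u else
     case (u, v) of
       (SK1 u', SK1 v') \<Rightarrow> SK1 (plus_val F1 u' v')
     | (SK2 u', SK2 v') \<Rightarrow> SK2 (plus_val F2 u' v')
     | _ \<Rightarrow> STop)"
| "plus_val (FProd F1 F2) u v =
    (case (u, v) of
       (SPair u1 u2, SPair v1 v2) \<Rightarrow> SPair (plus_val F1 u1 v1) (plus_val F2 u2 v2)
     | _ \<Rightarrow> SBot)"
| "plus_val (FExpo A F) u v =
    (case (u, v) of
       (SFun m, SFun n) \<Rightarrow>
         SFun (tabulate A (\<lambda>a. plus_val F (the (fmlookup m a)) (the (fmlookup n a))))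
     | _ \<Rightarrow> SBot)"
| "plus_val (FPow F) u v = (case (u, v) of (SSet U, SSet W) \<Rightarrow> SSet (U |\<union>| W) | _ \<Rightarrow> SBot)"

definition lam_val :: "'a fset \<Rightarrow> ('a, 'b) func \<Rightarrow> 'a \<Rightarrow> ('a, 'b) val \<Rightarrow> ('a, 'b) val" where
  "lam_val A F a u = SFun (tabulate A (\<lambda>a'. if a' = a then u else empty_val F))"

text \<open>
  Unfolding \<open>\<mu>x.\<gamma>\<close> terminates because substitution into a guarded \<open>\<gamma>\<close> leaves its
  \<^const>\<open>unguarded_size\<close> unchanged; \<^const>\<open>SBot\<close> is a junk value.
\<close>

function delta_val :: "('a, 'b) func \<Rightarrow> ('a, 'b) func \<Rightarrow> ('a, 'b) expr \<Rightarrow> ('a, 'b) val" where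
  "delta_val G F e =
    (if F = FId \<and> G \<noteq> FId then SId e else
     case e of
       EEmpty \<Rightarrow> empty_val F
     | EVar x \<Rightarrow> SBot
     | EPlus e1 e2 \<Rightarrow> plus_val F (delta_val G F e1) (delta_val G F e2)
     | EMu x g \<Rightarrow> if guarded g then delta_val G F (esubst x (EMu x g) g) else SBot
     | EConst b \<Rightarrow> SId (EConst b)
     | ELProd e' \<Rightarrow> (case F of FProd F1 F2 \<Rightarrow> SPair (delta_val G F1 e') (empty_val F2) | _ \<Rightarrow> SBot)
     | ERProd e' \<Rightarrow> (case F of FProd F1 F2 \<Rightarrow> SPair (empty_val F1) (delta_val G F2 e') | _ \<Rightarrow> SBot)
     | ELSum e' \<Rightarrow> (case F of FSum F1 F2 \<Rightarrow> SK1 (delta_val G F1 e') | _ \<Rightarrow> SBot)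
     | ERSum e' \<Rightarrow> (case F of FSum F1 F2 \<Rightarrow> SK2 (delta_val G F2 e') | _ \<Rightarrow> SBot)
     | EAct a e' \<Rightarrow> (case F of FExpo A F' \<Rightarrow> lam_val A F' a (delta_val G F' e') | _ \<Rightarrow> SBot)
     | ESing e' \<Rightarrow> (case F of FPow F' \<Rightarrow> SSet {|delta_val G F' e'|} | _ \<Rightarrow> SBot))"
  by pat_completeness auto
termination
  by (relation "measures [\<lambda>(G, F, e). size F, \<lambda>(G, F, e). unguarded_size e]")
     (auto simp: unguarded_size_esubst(2))

declare delta_val.simps [simp del]

text \<open>For \<open>G \<noteq> FId\<close> the clause at \<open>FId\<close> overlaps with those
  for \<open>EEmpty\<close> and \<open>EPlus\<close>. They agree, since \<open>empty_val FId\<close>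
  and \<open>plus_val FId\<close> rebuild the expression itself.\<close>

lemma delta_val_simps:
  "G \<noteq> FId \<Longrightarrow> delta_val G FId e = SId e"
  "delta_val G F EEmpty = empty_val F"
  "delta_val G F (EPlus e1 e2) = plus_val F (delta_val G F e1) (delta_val G F e2)"
  "guarded g \<Longrightarrow> delta_val G G (EMu x g) = delta_val G G (esubst x (EMu x g) g)"
  "delta_val G F (EConst b) = SId (EConst b)"
  "delta_val G (FProd F1 F2) (ELProd e) = SPair (delta_val G F1 e) (empty_val F2)"
  "delta_val G (FProd F1 F2) (ERProd e) = SPair (empty_val F1) (delta_val G F2 e)"
  "delta_val G (FSum F1 F2) (ELSum e) = SK1 (delta_val G F1 e)"
  "delta_val G (FSum F1 F2) (ERSum e) = SK2 (delta_val G F2 e)"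
  "delta_val G (FExpo A F) (EAct a e) = lam_val A F a (delta_val G F e)"
  "delta_val G (FPow F) (ESing e) = SSet {|delta_val G F e|}"
  by (subst delta_val.simps; simp add: delta_val.simps[of _ FId])+

lemma fmmap_eqI:
  assumes "fmdom m = A" "fmdom n = A"
    and "\<And>a. a |\<in>| A \<Longrightarrow> f (the (fmlookup m a)) = g (the (fmlookup n a))"
  shows "fmmap f m = fmmap g n"
proof (rule fmap_ext)
  fix a
  show "fmlookup (fmmap f m) a = fmlookup (fmmap g n) a"
  proof (cases "a |\<in>| A")
    case True
    then obtain x y where "fmlookup m a = Some x" "fmlookup n a = Some y"
      using assms(1,2) by (metis fmdomE)
    with assms(3)[OF True] show ?thesis by simp
  qed (use assms(1,2) in \<open>simp add: fmdom_notD\<close>)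
qed


section \<open>The model\<close>

primrec opr_val ::
  "('a, 'b) func \<Rightarrow> (('a, 'b) expr \<Rightarrow> ('a, 'b) expr) \<Rightarrow> ('a, 'b) opr \<Rightarrow> ('a, 'b) val list \<Rightarrow> ('a, 'b) val"
where
  "opr_val G r OEmpty vs = SId EEmpty"
| "opr_val G r (OVar x) vs = SId (EVar x)"
| "opr_val G r OPlus vs = SId (EPlus (val_expr (vs ! 0)) (val_expr (vs ! 1)))"
| "opr_val G r (OMu x) vs = SId (EMu x (val_expr (vs ! 0)))"
| "opr_val G r (OConst b) vs = SId (EConst b)"
| "opr_val G r OLProd vs = SId (ELProd (val_expr (vs ! 0)))"
| "opr_val G r ORProd vs = SId (ERProd (val_expr (vs ! 0)))"
| "opr_val G r OLSum vs = SId (ELSum (val_expr (vs ! 0)))"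
| "opr_val G r ORSum vs = SId (ERSum (val_expr (vs ! 0)))"
| "opr_val G r (OAct a) vs = SId (EAct a (val_expr (vs ! 0)))"
| "opr_val G r OSing vs = SId (ESing (val_expr (vs ! 0)))"
| "opr_val G r OPair vs = SPair (vs ! 0) (vs ! 1)"
| "opr_val G r OK1 vs = SK1 (vs ! 0)"
| "opr_val G r OK2 vs = SK2 (vs ! 0)"
| "opr_val G r OBot vs = SBot"
| "opr_val G r OTop vs = STop"
| "opr_val G r OTrue vs = SBot"
| "opr_val G r OFalse vs = SBot"
| "opr_val G r (OJoin B) vs = SId (EConst (slat_join B (val_const (vs ! 0)) (val_const (vs ! 1))))"
| "opr_val G r (OSubst x) vs = SId (esubst x (val_expr (vs ! 1)) (val_expr (vs ! 0)))"
| "opr_val G r (OCheck F) vs = SBot"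
| "opr_val G r OAnd vs = SBot"
| "opr_val G r (OEmptySt F) vs = empty_val F"
| "opr_val G r (OPlusSt F) vs = plus_val F (vs ! 0) (vs ! 1)"
| "opr_val G r (ODelta F) vs = delta_val G F (val_expr (vs ! 0))"
| "opr_val G r (OLam A F a) vs = lam_val A F a (vs ! 0)"
| "opr_val G r OFreeze vs = map_elt r (vs ! 0)"

primrec trm_val ::
  "('a, 'b) func \<Rightarrow> (('a, 'b) expr \<Rightarrow> ('a, 'b) expr) \<Rightarrow> (srt \<Rightarrow> nat \<Rightarrow> ('a, 'b) val) \<Rightarrow>
   ('a, 'b) trm \<Rightarrow> ('a, 'b) val"
where
  "trm_val G r \<rho> (V s n) = \<rho> s n"
| "trm_val G r \<rho> (Op f ts) = opr_val G r f (map (trm_val G r \<rho>) ts)"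
| "trm_val G r \<rho> (TFun m) = SFun (fmmap (trm_val G r \<rho>) m)"
| "trm_val G r \<rho> (TSet U) = SSet (trm_val G r \<rho> |`| U)"

text \<open>The carrier of \<open>GExp\<close> is restricted because the unfolding equation for
  \<open>EMu\<close> holds in \<open>delta_val\<close> only for guarded bodies.
  \<open>ExpStruct\<close> and \<open>Frozen\<close> may contain junk: the operations are total and
  respect the equations there too.\<close>

primrec srt_vals :: "srt \<Rightarrow> ('a, 'b) val set" where
  "srt_vals Slt = range (\<lambda>b. SId (EConst b))"
| "srt_vals GExp = SId ` {e. guarded e}"
| "srt_vals Exp = SId ` {e. expression e}"
| "srt_vals ExpStruct = UNIV"
| "srt_vals Bool = {SBot}"
| "srt_vals Frozen = UNIV"

lemma srt_vals_subsort: "subsort s s' \<Longrightarrow> srt_vals s \<subseteq> srt_vals s'"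
  by (induction rule: subsort.induct) (auto intro: expression_guarded.intros)

lemma opr_val_sort:
  assumes "has_rank G f ss s" "list_all2 (\<lambda>v s. v \<in> srt_vals s) vs ss"
  shows "opr_val G r f vs \<in> srt_vals s"
  using assms
  by cases (auto simp: list_all2_Cons2 intro: expression_guarded.intros esubst_sorts)

lemma trm_val_sort:
  assumes "has_sort G t s" and \<rho>: "\<And>s n. \<rho> s n \<in> srt_vals s"
  shows "trm_val G r \<rho> t \<in> srt_vals s"
  using assms(1)
proof (induction rule: has_sort.induct)
  case (2 f ss s ts)
  have "list_all2 (\<lambda>v s. v \<in> srt_vals s) (map (trm_val G r \<rho>) ts) ss"
    using 2(2) by (auto simp: list_all2_conv_all_nth)
  with 2(1) show ?case by (simp add: opr_val_sort)
next
  case (5 t s s')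
  then show ?case using srt_vals_subsort by blast
qed (auto simp: \<rho>)

lemma trm_val_inst:
  "trm_val G r \<rho> (inst \<theta> t) = trm_val G r (\<lambda>s n. trm_val G r \<rho> (\<theta> s n)) t"
proof (induction t)
  case (TFun m)
  then show ?case by (auto simp: fmap.map_comp intro!: fmap.map_cong0)
next
  case (TSet U)
  then show ?case by (auto simp: fset.map_comp intro!: fset.map_cong0)
qed (auto cong: map_cong)

lemma fmmap_tabulate: "fmmap f (tabulate A h) = tabulate A (f \<circ> h)"
  by (rule fmap_ext) auto

lemma spec_eq_valid:
  assumes "spec_eq G t u" and \<rho>: "\<And>s n. \<rho> s n \<in> srt_vals s"
  shows "trm_val G r \<rho> t = trm_val G r \<rho> u"
proof -
  have "\<exists>e. \<rho> Exp n = SId e" for n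
    using \<rho>[of Exp n] by auto
  then obtain e where [simp]: "\<And>n. \<rho> Exp n = SId (e n)"
    by metis
  have "\<exists>e. guarded e \<and> \<rho> GExp n = SId e" for n
    using \<rho>[of GExp n] by auto
  then obtain g where [simp]: "\<And>n. \<rho> GExp n = SId (g n)" "\<And>n. guarded (g n)"
    by metis
  have [simp]: "\<rho> Bool n = SBot" for n
    using \<rho>[of Bool n] by simp
  from assms(1) show ?thesis
  proof cases
    \<comment> \<open>The left argument is an arbitrary value here, so its constructor has to be
      split.\<close>
    case (plus_sum_top_r F1 F2)
    then show ?thesis by (simp split: elt.split)
  next
    case (plus_expo m1 A m2 F)
    \<comment> \<open>Both function terms have domain \<open>A\<close> in this equation, so every
      lookup is defined and evaluation commutes with \<open>the\<close>.\<close>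
    have *: "the (map_option (trm_val G r \<rho>) (fmlookup m a)) = trm_val G r \<rho> (the (fmlookup m a))"
      if "a |\<in>| fmdom m" for m a
      using that by (auto elim!: fmdomE)
    from plus_expo show ?thesis
      by (auto intro!: fmap_ext simp: *)
  qed (simp_all add: fimage_funion lam_val_def fmmap_tabulate comp_def if_distrib delta_val_simps cong: if_cong)
qed

lemma trm_val_expr_trm: "trm_val G r \<rho> (expr_trm e) = SId e"
  by (induction e) auto

text \<open>Congruence holds in any model. The rules on frozen terms hold because
  \<open>map_elt r\<close> commutes with pairs, injections, functions and sets. A hypothesis from
  \<open>R\<close> only requires \<open>r\<close> to identify its two sides; \<open>r\<close> need
  not respect the expression constructors.\<close>

lemma ndf_ded_valid:
  assumes "ndf_ded G (spec G \<union> frozen_eqs R) t u"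
    and \<rho>: "\<And>s n. \<rho> s n \<in> srt_vals s"
    and R: "\<And>e e'. (e, e') \<in> R \<Longrightarrow> r e = r e'"
  shows "trm_val G r \<rho> t = trm_val G r \<rho> u"
  using assms(1) \<rho>
proof (induction arbitrary: \<rho> rule: ndf_ded.induct)
  case (axiom t u)
  then show ?case
    by (auto simp: spec_def frozen_eqs_def trm_val_expr_trm R intro: spec_eq_valid)
next
  \<comment> \<open>Instantiating a term amounts to changing the valuation, which is why the
    induction keeps \<open>\<rho>\<close> arbitrary.\<close>
  case (subst t u \<theta>)
  then show ?case
    by (simp add: trm_val_inst trm_val_sort)
next
  case (congr ts us f)
  then have "map (trm_val G r \<rho>) ts = map (trm_val G r \<rho>) us"
    by (intro nth_equalityI) (auto simp: list_all2_conv_all_nth)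
  then show ?case by simp
next
  case (congr_fun m1 A m2)
  then have "fmmap (trm_val G r \<rho>) m1 = fmmap (trm_val G r \<rho>) m2"
    by (intro fmmap_eqI) auto
  then show ?case by simp
next
  case (congr_set ps U1 U2)
  then have "map (trm_val G r \<rho> \<circ> fst) ps = map (trm_val G r \<rho> \<circ> snd) ps"
    by auto
  then show ?case
    using congr_set(2,3) by (metis fset_of_list_map list.map_comp trm_val.simps(4))
next
  case (ndf_fun m1 A m2)
  then have "fmmap (map_elt r \<circ> trm_val G r \<rho>) m1 = fmmap (map_elt r \<circ> trm_val G r \<rho>) m2"
    by (intro fmmap_eqI) auto
  then show ?case by (simp add: fmap.map_comp)
next
  case (ndf_set ps U1 U2)
  then have "map (map_elt r \<circ> trm_val G r \<rho> \<circ> fst) ps = map (map_elt r \<circ> trm_val G r \<rho> \<circ> snd) ps"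
    by auto
  then have "(map_elt r \<circ> trm_val G r \<rho>) |`| U1 = (map_elt r \<circ> trm_val G r \<rho>) |`| U2"
    unfolding ndf_set(2,3) by (metis fset_of_list_map map_map)
  then show ?case by (simp add: fset.map_comp)
qed simp_all

section \<open>Recovering the lifting from equal frozen values\<close>

lemma lifting_FSum_FProd:
  fixes F1 F2 :: "('a, 'b) func" and C :: "('x \<times> 'x) set"
  shows "(u, v) \<in> lifting F1 C \<Longrightarrow> (SK1 u, SK1 v) \<in> lifting (FSum F1 F2) C"
    and "(u, v) \<in> lifting F2 C \<Longrightarrow> (SK2 u, SK2 v) \<in> lifting (FSum F1 F2) C"
    and "(SBot, SBot) \<in> lifting (FSum F1 F2) C"
    and "(STop, STop) \<in> lifting (FSum F1 F2) C"
    and "(u, v) \<in> lifting F1 C \<Longrightarrow> (u', v') \<in> lifting F2 C \<Longrightarrow>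
      (SPair u u', SPair v v') \<in> lifting (FProd F1 F2) C"
proof -
  have I: "(map_elt fst z, map_elt snd z) \<in> lifting F C" if "z \<in> fobj F C"
    for z :: "('a, 'b, 'x \<times> 'x) elt" and F
    using that by (auto simp: lifting_def)
  have E: "\<exists>z. u = map_elt fst z \<and> v = map_elt snd z \<and> z \<in> fobj F C"
    if "(u, v) \<in> lifting F C" for u v and F :: "('a, 'b) func"
    using that by (auto simp: lifting_def)
  show "(u, v) \<in> lifting F1 C \<Longrightarrow> (SK1 u, SK1 v) \<in> lifting (FSum F1 F2) C"
    using E[of u v F1] I[of "SK1 _" "FSum F1 F2"] by auto
  show "(u, v) \<in> lifting F2 C \<Longrightarrow> (SK2 u, SK2 v) \<in> lifting (FSum F1 F2) C"
    using E[of u v F2] I[of "SK2 _" "FSum F1 F2"] by auto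
  show "(SBot, SBot) \<in> lifting (FSum F1 F2) C" "(STop, STop) \<in> lifting (FSum F1 F2) C"
    using I[of SBot "FSum F1 F2"] I[of STop "FSum F1 F2"] by simp_all
  show "(SPair u u', SPair v v') \<in> lifting (FProd F1 F2) C"
    if "(u, v) \<in> lifting F1 C" "(u', v') \<in> lifting F2 C"
    using E[OF that(1)] E[OF that(2)] I[of "SPair _ _" "FProd F1 F2"] by auto
qed

text \<open>Both elements belong to the same functor, so equal frozen values can be compared
  constructor by constructor. At \<open>FId\<close> leaves equality under \<open>r\<close> gives a
  pair in \<open>C\<close>. At constant leaves it must give equality, which is the assumption
  \<open>rc\<close>.\<close>

lemma frozen_vals_lifting:
  assumes r: "\<And>x y. x \<in> X \<Longrightarrow> y \<in> X \<Longrightarrow> r x = r y \<Longrightarrow> (x, y) \<in> C"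
    and rc: "\<And>b c. r (EConst b) = r (EConst c) \<Longrightarrow> b = c"
  shows "u \<in> fobj F X \<Longrightarrow> v \<in> fobj F X \<Longrightarrow>
    trm_val G r \<rho> (frz (elt_trm u)) = trm_val G r \<rho> (frz (elt_trm v)) \<Longrightarrow> (u, v) \<in> lifting F C"
proof (induction F arbitrary: u v)
  case FId
  then obtain x y where "u = SId x" "v = SId y" "(x, y) \<in> C"
    using r by (auto simp: trm_val_expr_trm)
  then show ?case
    by (auto simp: lifting_def intro!: exI[of _ "SId (x, y)"])
next
  case (FConst B)
  then obtain b where "u = SConst b" "v = SConst b" "b \<in> slat_carrier B"
    using rc by auto
  then show ?case
    by (auto simp: lifting_def intro!: exI[of _ "SConst b"])
next
  case (FSum F1 F2)
  then show ?case
    by (auto intro!: lifting_FSum_FProd)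
next
  case (FProd F1 F2)
  then show ?case
    by (auto intro!: lifting_FSum_FProd)
next
  case (FExpo A F)
  from FExpo.prems obtain m n where uv: "u = SFun m" "v = SFun n"
    and dom: "fmdom m = A" "fmdom n = A"
    and ran: "fmran' m \<subseteq> fobj F X" "fmran' n \<subseteq> fobj F X"
    and eq: "fmmap (map_elt r \<circ> trm_val G r \<rho> \<circ> elt_trm) m = fmmap (map_elt r \<circ> trm_val G r \<rho> \<circ> elt_trm) n"
    by (auto simp: fmap.map_comp comp_assoc)
  have "\<exists>z. z \<in> fobj F C \<and> fmlookup m a = Some (map_elt fst z) \<and> fmlookup n a = Some (map_elt snd z)"
    if a: "a |\<in>| A" for a
  proof -
    obtain x y where xy: "fmlookup m a = Some x" "fmlookup n a = Some y"
      using a dom by (metis fmdomE)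
    then have "x \<in> fobj F X" "y \<in> fobj F X"
      using ran by (auto intro: fmran'I)
    moreover have "map_elt r (trm_val G r \<rho> (elt_trm x)) = map_elt r (trm_val G r \<rho> (elt_trm y))"
      using arg_cong[OF eq, of "\<lambda>m. fmlookup m a"] xy by simp
    ultimately have "(x, y) \<in> lifting F C"
      using FExpo.IH by simp
    with xy show ?thesis by (auto simp: lifting_def)
  qed
  then obtain z where z: "\<And>a. a |\<in>| A \<Longrightarrow>
    z a \<in> fobj F C \<and> fmlookup m a = Some (map_elt fst (z a)) \<and> fmlookup n a = Some (map_elt snd (z a))"
    by metis
  have "SFun (tabulate A z) \<in> fobj (FExpo A F) C"
    using z by (auto elim!: fmran'E split: if_splits intro!: fset_eqI fmdomI)
  moreover have "fmmap (map_elt fst) (tabulate A z) = m" "fmmap (map_elt snd) (tabulate A z) = n"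
    using z dom by (auto intro!: fmap_ext simp: fmdom_notD)
  ultimately show ?case
    unfolding lifting_def uv mem_Collect_eq by (intro exI[of _ "SFun (tabulate A z)"]) simp
next
  case (FPow F)
  define q where "q = map_elt r \<circ> trm_val G r \<rho> \<circ> elt_trm"
  from FPow.prems obtain U W where uv: "u = SSet U" "v = SSet W"
    and sub: "fset U \<subseteq> fobj F X" "fset W \<subseteq> fobj F X"
    by auto
  have eq: "q |`| U = q |`| W"
    using FPow.prems(3) by (simp add: uv q_def fset.map_comp comp_assoc)
  \<comment> \<open>\<open>P\<close> consists of all pairs from \<open>U\<close> and
    \<open>W\<close> with equal frozen values. Equality of the two images makes both projections of
    \<open>P\<close> surjective, so witnesses for its pairs form a witness for
    \<open>(U, W)\<close>.\<close>
  obtain P where P: "fset P = {(x, y). x \<in> fset U \<and> y \<in> fset W \<and> q x = q y}"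
  proof
    have "finite {(x, y). x \<in> fset U \<and> y \<in> fset W \<and> q x = q y}"
      by (rule finite_subset[of _ "fset U \<times> fset W"]) auto
    then show "fset (Abs_fset {(x, y). x \<in> fset U \<and> y \<in> fset W \<and> q x = q y}) =
        {(x, y). x \<in> fset U \<and> y \<in> fset W \<and> q x = q y}"
      by (simp add: Abs_fset_inverse)
  qed
  have "(x, y) \<in> lifting F C" if "(x, y) |\<in>| P" for x y
    using that sub FPow.IH[of x y] by (auto simp: P q_def)
  then have "\<exists>z. z \<in> fobj F C \<and> p = (map_elt fst z, map_elt snd z)" if "p |\<in>| P" for p
    using that by (cases p) (auto simp: lifting_def)
  then obtain z where z: "\<And>p. p |\<in>| P \<Longrightarrow> z p \<in> fobj F C \<and> p = (map_elt fst (z p), map_elt snd (z p))"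
    by metis
  have "SSet (z |`| P) \<in> fobj (FPow F) C"
    using z by auto
  moreover have "map_elt fst |`| (z |`| P) = fst |`| P" "map_elt snd |`| (z |`| P) = snd |`| P"
    unfolding fset.map_comp using z by (auto intro!: fset.map_cong0 simp: prod_eq_iff)
  moreover have "q ` fset U = q ` fset W"
    using arg_cong[OF eq, of fset] by simp
  then have "fst ` fset P = fset U" "snd ` fset P = fset W"
    unfolding P by (force simp: image_iff set_eq_iff)+
  then have "fst |`| P = U" "snd |`| P = W"
    by (simp_all flip: fset_inject)
  ultimately show ?case
    unfolding lifting_def uv mem_Collect_eq by (intro exI[of _ "SSet (z |`| P)"]) simp
qed


section \<open>Completeness\<close>

lemma expr_trm_sort:
  "expression e \<Longrightarrow> has_sort G (expr_trm e) Exp"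
  "guarded e \<Longrightarrow> has_sort G (expr_trm e) GExp"
  by (induction e rule: expression_guarded.inducts)
     (auto intro: has_sort.intros(2) has_rank.intros has_sort.intros(5)[OF _ subsort.intros(4)]
       has_sort.intros(5)[OF has_sort.intros(2)[OF has_rank.intros(6)] subsort.intros(3)])

lemma elt_trm_sort:
  "u \<in> fobj F X \<Longrightarrow> X \<subseteq> {e. expression e} \<Longrightarrow> has_sort G (elt_trm u) ExpStruct"
proof (induction F arbitrary: u)
  case FId
  then show ?case
    by (auto intro!: has_sort.intros(5)[OF expr_trm_sort(1) subsort.intros(5)])
next
  case (FConst B)
  have "subsort Slt ExpStruct"
    by (meson subsort.intros)
  then have "has_sort G (Op (OConst b) []) ExpStruct" for b
    by (rule has_sort.intros(5)[rotated]) (simp add: has_sort.intros(2)[OF has_rank.intros(6)])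
  then show ?case
    using FConst by auto
next
  case (FExpo A F)
  then show ?case
    by (fastforce intro!: has_sort.intros(3) simp: fmran'_def)
next
  case (FPow F)
  then show ?case
    by (fastforce intro!: has_sort.intros(4))
qed (auto intro!: has_sort.intros(2) has_rank.intros)

lemma well_sorted_frz: "has_sort G t s \<Longrightarrow> s \<noteq> Frozen \<Longrightarrow> well_sorted G (frz t)"
  unfolding well_sorted_def
  by (rule exI[of _ Frozen], rule has_sort.intros(2)[OF has_rank.intros(29)]) auto

text \<open>The functor acts on maps. The projections give well-sortedness of the two sides of a
  lifted pair, and the identity gives monotonicity of the lifting.\<close>

lemma map_elt_fobj: "z \<in> fobj F C \<Longrightarrow> f ` C \<subseteq> X \<Longrightarrow> map_elt f z \<in> fobj F X"
proof (induction F arbitrary: z)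
  case FId
  then show ?case by auto
next
  case (FExpo A F)
  then obtain m where m: "z = SFun m" "fmdom m = A" "fmran' m \<subseteq> fobj F C"
    by auto
  with FExpo show ?case
    by (auto simp: fmran'_def)
next
  case (FPow F)
  then obtain U where "z = SSet U" "fset U \<subseteq> fobj F C"
    by auto
  with FPow show ?case
    by auto
qed auto

text \<open>The induction follows the witness \<open>z\<close> in \<open>F(C)\<close>: each
  structural constructor has its own rule on frozen terms, constants, bottom and top are reflexive,
  and pairs in \<open>C\<close> are derivable by assumption.\<close>

lemma ndf_ded_lifting:
  assumes C: "C \<subseteq> X \<times> X" and X: "X \<subseteq> {e. expression e}"
    and ded: "\<And>e e'. (e, e') \<in> C \<Longrightarrow> ndf_ded G E (frz (expr_trm e)) (frz (expr_trm e'))"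
  shows "z \<in> fobj F C \<Longrightarrow>
    ndf_ded G E (frz (elt_trm (map_elt fst z))) (frz (elt_trm (map_elt snd z)))"
proof (induction F arbitrary: z)
  \<comment> \<open>Both projections of \<open>z\<close> lie in \<open>F(X)\<close>, which yields
    the sort conditions of all the rules used.\<close>
  have sorts: "has_sort G (elt_trm (map_elt fst z)) ExpStruct"
    "has_sort G (elt_trm (map_elt snd z)) ExpStruct"
    if "z \<in> fobj F C" for F z
    using that C X by (auto intro!: elt_trm_sort[of _ F X] map_elt_fobj[of _ F C])
  note ws = sorts[THEN exI[where P = "has_sort G _"], folded well_sorted_def]
  note ws_frz = sorts(1)[THEN well_sorted_frz]
  {
    case FId
    then show ?case using ded by auto
  next
    case (FConst B)
    from ws_frz[OF FConst] FConst show ?case by (auto intro: ndf_ded.refl)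
  next
    case (FSum F1 F2)
    consider x where "z = SK1 x" "x \<in> fobj F1 C" | x where "z = SK2 x" "x \<in> fobj F2 C"
      | "z = SBot \<or> z = STop"
      using FSum.prems by auto
    then show ?case
    proof cases
      case 1
      with FSum.IH(1)[of x] ws[OF FSum.prems] show ?thesis by (simp add: ndf_k1)
    next
      case 2
      with FSum.IH(2)[of x] ws[OF FSum.prems] show ?thesis by (simp add: ndf_k2)
    next
      case 3
      with ws_frz[OF FSum.prems] show ?thesis by (auto intro: ndf_ded.refl)
    qed
  next
    case (FProd F1 F2)
    then obtain x y where "z = SPair x y" "x \<in> fobj F1 C" "y \<in> fobj F2 C"
      by auto
    with FProd.IH[of x] FProd.IH(2)[of y] ws[OF FProd.prems] show ?case by (simp add: ndf_pair)
  next
    case (FExpo A F)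
    then obtain m where z: "z = SFun m" and m: "fmdom m = A" "fmran' m \<subseteq> fobj F C"
      by auto
    have "ndf_ded G E (frz (the (fmlookup (fmmap elt_trm (fmmap (map_elt fst) m)) a)))
        (frz (the (fmlookup (fmmap elt_trm (fmmap (map_elt snd) m)) a)))" if a: "a |\<in>| A" for a
    proof -
      obtain x where x: "fmlookup m a = Some x"
        using a m(1) fmdomE[of a m] by metis
      have "x \<in> fobj F C"
        using fmran'I[OF x] m(2) by (rule rev_subsetD)
      from FExpo.IH[OF this] x show ?thesis by simp
    qed
    then show ?case
      using ws[OF FExpo.prems] m unfolding z elt.map elt_trm.simps
      by (intro ndf_fun[where A = A]) auto
  next
    case (FPow F)
    then obtain U where z: "z = SSet U" and U: "fset U \<subseteq> fobj F C"
      by auto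
    obtain xs where xs: "U = fset_of_list xs"
      by (metis exists_fset_of_list)
    \<comment> \<open>One pair of projections for each listed element of \<open>U\<close>, which is
      the enumeration that \<open>ndf_set\<close> asks for.\<close>
    define ps where "ps = map (\<lambda>x. (elt_trm (map_elt fst x), elt_trm (map_elt snd x))) xs"
    have "\<forall>(t, u)\<in>set ps. ndf_ded G E (frz t) (frz u)"
      using FPow.IH U xs by (auto simp: ps_def fset_of_list.rep_eq)
    moreover have "elt_trm |`| (map_elt fst |`| U) = fset_of_list (map fst ps)"
      "elt_trm |`| (map_elt snd |`| U) = fset_of_list (map snd ps)"
      by (simp_all add: xs ps_def comp_def flip: fset_of_list_map)
    ultimately show ?case
      using ws[OF FPow.prems] unfolding z elt.map elt_trm.simps by (rule ndf_set)
  }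
qed

text \<open>Derivability between frozen expressions is symmetric and transitive, contains
  \<open>R\<close> through the axioms, and is reflexive on \<open>Exprs G\<close> because those
  terms are well sorted.\<close>

lemma ndf_ded_cl_on:
  assumes "R \<subseteq> Exprs G \<times> Exprs G"
    and "(e, e') \<in> cl_on (Exprs G) (R \<union> {(e, e) |e. e \<in> Exprs G})"
  shows "ndf_ded G (spec G \<union> frozen_eqs R) (frz (expr_trm e)) (frz (expr_trm e'))"
proof -
  let ?D = "\<lambda>e e'. ndf_ded G (spec G \<union> frozen_eqs R) (frz (expr_trm e)) (frz (expr_trm e'))"
  let ?Q = "R \<union> {(e, e) |e. e \<in> Exprs G}"
  have rfl: "?D e e" if "e \<in> Exprs G" for e
    using that by (auto simp: Exprs_def intro!: ndf_ded.refl well_sorted_frz[of _ _ Exp] expr_trm_sort)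
  have R: "?D e e'" if "(e, e') \<in> R" for e e'
    using that by (intro ndf_ded.axiom) (auto simp: frozen_eqs_def)
  have "?D e e'" if "(e, e') \<in> (?Q \<union> ?Q\<inverse>)\<^sup>+" for e e'
    using that
  proof induction
    case (base y)
    then show ?case using rfl R by (auto intro: ndf_ded.sym)
  next
    case (step y z)
    then have "?D y z" using rfl R by (auto intro: ndf_ded.sym)
    with step.IH show ?case by (rule ndf_ded.trans)
  qed
  with assms(2) rfl show ?thesis
    by (auto simp: cl_on_def)
qed

lemma cl_on_subset:
  assumes "R \<subseteq> X \<times> X" shows "cl_on X R \<subseteq> X \<times> X"
proof -
  have "(R \<union> R\<inverse>)\<^sup>+ \<subseteq> X \<times> X"
    using assms by (intro trancl_subset_Sigma) auto
  then show ?thesis by (auto simp: cl_on_def)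
qed


section \<open>Soundness\<close>

text \<open>Besides the rule for constants, only the rule for \<open>FId\<close> can type a
  constant, and it goes back to type \<open>G\<close>. Hence \<open>F\<close> is general and the
  conclusion a disjunction.\<close>

lemma typed_EConst:
  "typed G e F \<Longrightarrow> e = EConst b \<Longrightarrow> constant_functor F \<or> constant_functor G"
  by (induction rule: typed.induct) (auto simp: constant_functor_def)

lemma ingredient_FConst: "F \<lhd>\<^sub>F G \<Longrightarrow> G = FConst B \<Longrightarrow> F = FConst B"
  by (induction rule: ingredient.induct) auto

lemma exists_representatives:
  fixes S :: "('x \<times> 'x) set"
  assumes "equiv UNIV S"
  shows "\<exists>r :: 'x \<Rightarrow> 'x. \<forall>x y. r x = r y \<longleftrightarrow> (x, y) \<in> S"
proof (intro exI allI)
  fix x y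
  show "(SOME z. z \<in> S `` {x}) = (SOME z. z \<in> S `` {y}) \<longleftrightarrow> (x, y) \<in> S"
  proof
    have some: "(x, SOME z. z \<in> S `` {x}) \<in> S" for x
      using equiv_class_self[OF assms, of x] by (metis UNIV_I Image_singleton_iff someI)
    assume "(SOME z. z \<in> S `` {x}) = (SOME z. z \<in> S `` {y})"
    then show "(x, y) \<in> S"
      using some[of x] some[of y] assms by (metis equivE symD transD)
  next
    assume "(x, y) \<in> S"
    then show "(SOME z. z \<in> S `` {x}) = (SOME z. z \<in> S `` {y})"
      using equiv_class_eq[OF assms] by metis
  qed
qed

text \<open>The representatives of the classes generated by \<open>R\<close> are used as
  \<open>r\<close> in the model. Either alternative on \<open>G\<close> and \<open>R\<close> keeps
  constants out of \<open>R\<close>, so \<open>r\<close> stays injective on them.\<close>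

lemma ndf_ded_imp_lifting:
  assumes R: "R \<subseteq> Exprs G \<times> Exprs G" and G: "\<not> constant_functor G \<or> R = {}"
    and "u \<in> fobj F (Exprs G)" "v \<in> fobj F (Exprs G)"
    and ded: "ndf_ded G (spec G \<union> frozen_eqs R) (frz (elt_trm u)) (frz (elt_trm v))"
  shows "(u, v) \<in> lifting F (cl_on (Exprs G) R)"
proof -
  \<comment> \<open>Reflexive on all expressions, since \<open>r\<close> must be total; between
    members of \<open>Exprs G\<close> it implies membership in \<open>cl_on\<close>.\<close>
  let ?S = "(R \<union> R\<inverse>)\<^sup>*"
  have "equiv UNIV ?S"
    by (intro equivI refl_rtrancl sym_rtrancl trans_rtrancl sym_Un_converse) auto
  then obtain r :: "('a, 'b) expr \<Rightarrow> ('a, 'b) expr"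
    where r: "\<And>x y. r x = r y \<longleftrightarrow> (x, y) \<in> ?S"
    using exists_representatives by blast
  have "(EConst b, y) \<notin> R \<union> R\<inverse>" for b y
    using R G typed_EConst[of G _ G b] by (auto simp: Exprs_def)
  then have const: "b = c" if "r (EConst b) = r (EConst c)" for b c
    using that unfolding r by (auto elim: converse_rtranclE)
  have cl: "(x, y) \<in> cl_on (Exprs G) R" if "x \<in> Exprs G" "y \<in> Exprs G" "r x = r y" for x y
    using that unfolding r by (auto simp: cl_on_def rtrancl_eq_or_trancl)
  \<comment> \<open>Any valuation respecting the sorts will do. A constant expression lies in every
    carrier except that of \<open>Bool\<close>.\<close>
  define \<rho> :: "srt \<Rightarrow> nat \<Rightarrow> ('a, 'b) val" where
    "\<rho> = (\<lambda>s n. if s = Bool then SBot else SId (EConst undefined))"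
  have "\<rho> s n \<in> srt_vals s" for s n
    by (cases s) (auto simp: \<rho>_def intro: expression_guarded.intros)
  then have "trm_val G r \<rho> (frz (elt_trm u)) = trm_val G r \<rho> (frz (elt_trm v))"
    using ndf_ded_valid[OF ded] r by (metis UnI1 r_into_rtrancl)
  with cl const assms(3,4) show ?thesis
    by (rule frozen_vals_lifting)
qed

section \<open>Monotonicity of lifting and closure, and the conclusion\<close>

lemma lifting_mono: "R \<subseteq> S \<Longrightarrow> lifting F R \<subseteq> lifting F S"
  using map_elt_fobj[of _ F R id S] by (auto simp: lifting_def elt.map_id0)

lemma cl_on_mono: "R \<subseteq> S \<Longrightarrow> cl_on X R \<subseteq> cl_on X S"
  unfolding cl_on_def by (intro Un_mono subset_refl subsetI) (erule trancl_mono, auto)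

theorem theorem2:
  fixes G F :: "('a, 'b) func"
    and R :: "(('a, 'b) expr \<times> ('a, 'b) expr) set"
    and \<sigma> \<sigma>' :: "('a, 'b, ('a, 'b) expr) elt"
  assumes "nd_functor G"
    and "F \<lhd>\<^sub>F G"
    and "R \<subseteq> Exprs G \<times> Exprs G"
    and "\<sigma> \<in> fobj F (Exprs G)"
    and "\<sigma>' \<in> fobj F (Exprs G)"
  shows "(\<not> constant_functor G \<longrightarrow>
            ((\<sigma>, \<sigma>') \<in> lifting F (cl_on (Exprs G) (R \<union> {(e, e) |e. e \<in> Exprs G})) \<longleftrightarrow>
             ndf_ded G (spec G \<union> frozen_eqs R) (frz (elt_trm \<sigma>)) (frz (elt_trm \<sigma>')))) \<and>
         (\<forall>B. G = FConst B \<longrightarrow>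
            ((\<sigma>, \<sigma>') \<in> lifting (FConst B) (cl_on (Exprs G) (R \<union> {(e, e) |e. e \<in> Exprs G})) \<longleftrightarrow>
             ndf_ded G (spec G) (frz (elt_trm \<sigma>)) (frz (elt_trm \<sigma>'))))"
proof (intro conjI impI allI)
  let ?Q = "R \<union> {(e, e) |e. e \<in> Exprs G}"
  have expr: "Exprs G \<subseteq> {e. expression e}"
    by (auto simp: Exprs_def)
  {
    assume G: "\<not> constant_functor G"
    show "(\<sigma>, \<sigma>') \<in> lifting F (cl_on (Exprs G) ?Q) \<longleftrightarrow>
      ndf_ded G (spec G \<union> frozen_eqs R) (frz (elt_trm \<sigma>)) (frz (elt_trm \<sigma>'))"
    proof
      have "cl_on (Exprs G) ?Q \<subseteq> Exprs G \<times> Exprs G"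
        using assms(3) by (intro cl_on_subset) auto
      moreover assume "(\<sigma>, \<sigma>') \<in> lifting F (cl_on (Exprs G) ?Q)"
      ultimately show "ndf_ded G (spec G \<union> frozen_eqs R) (frz (elt_trm \<sigma>)) (frz (elt_trm \<sigma>'))"
        using ndf_ded_lifting[OF _ expr ndf_ded_cl_on[OF assms(3)]] by (auto simp: lifting_def)
    next
      assume "ndf_ded G (spec G \<union> frozen_eqs R) (frz (elt_trm \<sigma>)) (frz (elt_trm \<sigma>'))"
      \<comment> \<open>Soundness gives the lifting of the closure of \<open>R\<close>; adding the
        diagonal to \<open>R\<close> can only enlarge it.\<close>
      then have "(\<sigma>, \<sigma>') \<in> lifting F (cl_on (Exprs G) R)"
        using G assms(3-5) by (intro ndf_ded_imp_lifting) auto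
      also have "\<dots> \<subseteq> lifting F (cl_on (Exprs G) ?Q)"
        by (intro lifting_mono cl_on_mono) auto
      finally show "(\<sigma>, \<sigma>') \<in> lifting F (cl_on (Exprs G) ?Q)" .
    qed
  }
  fix B
  assume B: "G = FConst B"
  then have F: "F = FConst B"
    using assms(2) ingredient_FConst by blast
  show "(\<sigma>, \<sigma>') \<in> lifting (FConst B) (cl_on (Exprs G) ?Q) \<longleftrightarrow>
      ndf_ded G (spec G) (frz (elt_trm \<sigma>)) (frz (elt_trm \<sigma>'))"
  proof
    assume "(\<sigma>, \<sigma>') \<in> lifting (FConst B) (cl_on (Exprs G) ?Q)"
    \<comment> \<open>Elements of a constant functor contain no expressions, so both projections fix
      the constant.\<close>
    then have "\<sigma> = \<sigma>'"
      by (auto simp: lifting_def)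
    moreover have "well_sorted G (frz (elt_trm \<sigma>))"
      by (rule well_sorted_frz[OF elt_trm_sort[OF assms(4) expr]]) simp
    ultimately show "ndf_ded G (spec G) (frz (elt_trm \<sigma>)) (frz (elt_trm \<sigma>'))"
      by (simp add: ndf_ded.refl)
  next
    assume "ndf_ded G (spec G) (frz (elt_trm \<sigma>)) (frz (elt_trm \<sigma>'))"
    \<comment> \<open>Deduction from the specification alone is the instance of soundness with the
      empty relation.\<close>
    then have "(\<sigma>, \<sigma>') \<in> lifting F (cl_on (Exprs G) {})"
      using assms(4,5) by (intro ndf_ded_imp_lifting) (auto simp: frozen_eqs_def)
    also have "\<dots> \<subseteq> lifting F (cl_on (Exprs G) ?Q)"
      by (intro lifting_mono cl_on_mono) auto
    finally show "(\<sigma>, \<sigma>') \<in> lifting (FConst B) (cl_on (Exprs G) ?Q)"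
      by (simp add: F)
  qed
qed

end
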